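(* Let $E$ be a finite set with $|E|\ge2$, let $K\subseteq\mathbb R_+^E$ be a rational polyhedral cone, and let $P=K\cap[0,1]^E$. Then $$s(P)\le\operatorname{br}_{\cup}(\mathcal Z(P)).$$ Consequently, $s(P)\le\min\{|E|-1,\ \operatorname{br}_{\cup}(\mathcal Z(P))\}$.
   Context: For $y\in\mathbb R_+^E$, $\operatorname{supp}(y)=\{e\in E:y_e>0\}$. For $c\in\mathbb R^E$ let $\alpha(c)=\max\{c^\top y:y\in P\}$. For $c$ with $\alpha(c)>0$ and an integer $\ell\ge1$, $\mathcal B_\ell(c)$ is the family of sets $J\subseteq E$ such that for all $z^1,\dots,z^\ell\in P$: $\left(\bigcap_{i=1}^\ell\operatorname{supp}(z^i)\right)\cap J=\emptyset$ implies $\sum_{i=1}^\ell c^\top z^i\le\alpha(c)(\ell-1)$. $\mathcal B_\infty(c)=\bigcap_{\ell\ge1}\mathcal B_\ell(c)$. The universal stabilization depth of $P$ is $$s(P)=\min\{q\ge1:\ \mathcal B_q(c)=\mathcal B_\infty(c)\text{ for every }c\text{ with }\alpha(c)>0\}.$$ Let $r^1,\dots,r^m$ be the nonzero vertices of $P$, $Z_j=\{e\in E:r^j_e=0\}$ and $\mathcal Z(P)=(Z_1,\dots,Z_m)$. The (semilattice) breadth $\operatorname{br}_{\cup}(\mathcal Z(P))$ is the smallest integer $q\ge1$ such that for every $S\subseteq\{1,\dots,m\}$ there is $T\subseteq S$ with $|T|\le q$ and $\bigcup_{j\in T}Z_j=\bigcup_{j\in S}Z_j$. *)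

theory Defs
  imports "HOL-Analysis.Analysis"
begin

text \<open>
  The ground set is the universe of a finite type \<open>'e\<close>, and a vector indexed by it
  is an element of \<open>real ^ 'e\<close>.
\<close>

definition rational_polyhedral_cone :: "(real ^ 'e::finite) set \<Rightarrow> bool" where
  "rational_polyhedral_cone K \<longleftrightarrow>
     (\<exists>A. finite A \<and> (\<forall>a\<in>A. \<forall>e. a $ e \<in> \<rat>) \<and> K = {x. \<forall>a\<in>A. a \<bullet> x \<le> 0})"

definition supp :: "real ^ 'e::finite \<Rightarrow> 'e set" where
  "supp y = {e. 0 < y $ e}"

text \<open>
  The supremum is a maximum for the sets of interest, which are compact and contain 0.
\<close>

definition alpha :: "(real ^ 'e::finite) set \<Rightarrow> real ^ 'e \<Rightarrow> real" where
  "alpha P c = (SUP y\<in>P. c \<bullet> y)"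

definition blocking :: "(real ^ 'e::finite) set \<Rightarrow> real ^ 'e \<Rightarrow> nat \<Rightarrow> 'e set set" where
  "blocking P c l =
     {J. \<forall>z. (\<forall>i\<in>{1..l}. z i \<in> P) \<longrightarrow> (\<Inter>i\<in>{1..l}. supp (z i)) \<inter> J = {} \<longrightarrow>
            (\<Sum>i\<in>{1..l}. c \<bullet> z i) \<le> alpha P c * (real l - 1)}"

definition blocking_inf :: "(real ^ 'e::finite) set \<Rightarrow> real ^ 'e \<Rightarrow> 'e set set" where
  "blocking_inf P c = (\<Inter>l\<in>{1..}. blocking P c l)"

text \<open>
  The minimum is taken in \<open>enat\<close>, so that it would be \<open>\<infinity>\<close> if no depth stabilized.
\<close>

definition stabilization_depth :: "(real ^ 'e::finite) set \<Rightarrow> enat" where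
  "stabilization_depth P =
     (INF q\<in>{q. 1 \<le> q \<and> (\<forall>c. 0 < alpha P c \<longrightarrow> blocking P c q = blocking_inf P c)}. enat q)"

definition nonzero_vertices :: "(real ^ 'e::finite) set \<Rightarrow> (real ^ 'e) set" where
  "nonzero_vertices P = {v. v extreme_point_of P \<and> v \<noteq> 0}"

definition zero_set :: "real ^ 'e::finite \<Rightarrow> 'e set" where
  "zero_set r = {e. r $ e = 0}"

text \<open>
  Breadth of a family \<open>Z\<close> of sets over an index set \<open>I\<close>. The family of zero sets of a
  polytope is indexed by its nonzero vertices themselves.
\<close>

definition union_breadth :: "'i set \<Rightarrow> ('i \<Rightarrow> 'a set) \<Rightarrow> nat" where
  "union_breadth I Z =
     (LEAST q. 1 \<le> q \<and>
        (\<forall>S\<subseteq>I. \<exists>T\<subseteq>S. finite T \<and> card T \<le> q \<and> (\<Union>j\<in>T. Z j) = (\<Union>j\<in>S. Z j)))"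

definition zero_set_breadth :: "(real ^ 'e::finite) set \<Rightarrow> nat" where
  "zero_set_breadth P = union_breadth (nonzero_vertices P) zero_set"

end

theory Submission
  imports Defs
begin

text \<open>
  Call \<open>alpha P c - c \<bullet> y\<close> the deficit of a point \<open>y\<close> of \<open>P\<close>; it is nonnegative. In these
  terms \<open>J\<close> belongs to \<open>blocking P c l\<close> iff any \<open>l\<close> points of \<open>P\<close> whose zero sets cover \<open>J\<close>
  have total deficit at least \<open>alpha P c\<close>. An optimal point has deficit 0, so adding optimal
  points changes nothing: the condition for \<open>q\<close> already speaks about all families of at most \<open>q\<close>
  points (\<open>deficit_ge_if_blocking\<close>). To bound the stabilization depth by \<open>q\<close> it therefore
  suffices to show that a family of total deficit less than \<open>alpha P c\<close> whose zero sets cover \<open>J\<close>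
  can be replaced by one with at most \<open>q\<close> members; passing to a subfamily never increases the
  deficit, so only the covering has to be preserved.

  For the breadth bound, each point is first moved to a vertex of \<open>P\<close> whose zero set is at least
  as large and whose deficit is no larger (\<open>exists_vertex_of_zero_face\<close>). The origin has deficit
  \<open>alpha P c\<close>, so none of these vertices is 0, and the definition of breadth selects at most
  \<open>zero_set_breadth P\<close> of them with the same union of zero sets.

  For the bound \<open>n - 1\<close>, where \<open>n\<close> is the dimension, choose for each element of \<open>J\<close> one point
  that vanishes there. This leaves at most \<open>n - 1\<close> points, unless there are exactly \<open>n\<close> of them and
  \<open>J\<close> is the whole ground set. In that case every coordinate vanishes at one of the \<open>n\<close> points,
  so their sum divided by \<open>n - 1\<close> still lies in the unit cube, hence in \<open>P\<close>; its value is at most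
  \<open>alpha P c\<close>, which says that the total deficit was at least \<open>alpha P c\<close> after all.
\<close>

section \<open>Blocking sets in terms of deficits\<close>

lemma alpha_attained:
  fixes P :: "(real ^ 'e::finite) set"
  assumes "compact P" "P \<noteq> {}"
  obtains y where "y \<in> P" "c \<bullet> y = alpha P c" "\<And>z. z \<in> P \<Longrightarrow> c \<bullet> z \<le> alpha P c"
proof -
  have "continuous_on P (\<lambda>y. c \<bullet> y)"
    by (intro continuous_intros)
  then obtain y where y: "y \<in> P" "\<And>z. z \<in> P \<Longrightarrow> c \<bullet> z \<le> c \<bullet> y"
    using continuous_attains_sup[OF assms] by blast
  have "alpha P c = c \<bullet> y"
    unfolding alpha_def using y by (intro cSup_eq_maximum) auto
  with y show ?thesis
    by (intro that[of y]) auto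
qed

lemma inner_le_alpha:
  fixes P :: "(real ^ 'e::finite) set"
  assumes "compact P" "z \<in> P"
  shows "c \<bullet> z \<le> alpha P c"
proof -
  have "P \<noteq> {}"
    using assms(2) by blast
  then show ?thesis
    using alpha_attained[OF assms(1)] assms(2) by metis
qed

text \<open>
  An indexed family with fewer than \<open>q\<close> members is brought to length \<open>q\<close> by repeating an
  optimal point, which has deficit 0 and can only enlarge the covered set.
\<close>

lemma deficit_ge_if_blocking:
  fixes P :: "(real ^ 'e::finite) set"
  assumes "compact P" "P \<noteq> {}" and J: "J \<in> blocking P c q"
    and I: "finite I" "card I \<le> q"
    and z: "\<And>i. i \<in> I \<Longrightarrow> z i \<in> P"
    and cover: "\<And>e. e \<in> J \<Longrightarrow> \<exists>i\<in>I. e \<notin> supp (z i)"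
  shows "alpha P c \<le> (\<Sum>i\<in>I. alpha P c - c \<bullet> z i)"
proof -
  obtain y where y: "y \<in> P" "c \<bullet> y = alpha P c"
    using alpha_attained[OF assms(1,2)] by metis
  obtain h where h: "bij_betw h {1..card I} I"
    using bij_betw_from_nat_into_finite ex_bij_betw_nat_finite_1[OF I(1)] by blast
  define w where "w k = (if k \<le> card I then z (h k) else y)" for k
  have h_in: "h k \<in> I" if "k \<in> {1..card I}" for k
    using h that by (auto simp: bij_betw_def)
  have "\<forall>k\<in>{1..q}. w k \<in> P"
    using y(1) z h_in by (auto simp: w_def)
  moreover have "(\<Inter>k\<in>{1..q}. supp (w k)) \<inter> J = {}"
  proof -
    have "\<exists>k\<in>{1..q}. e \<notin> supp (w k)" if "e \<in> J" for e
    proof -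
      from cover[OF that] obtain i where i: "i \<in> I" "e \<notin> supp (z i)"
        by blast
      then obtain k where "k \<in> {1..card I}" "h k = i"
        using h by (metis bij_betw_imp_surj_on imageE)
      with i I(2) show ?thesis
        by (intro bexI[of _ k]) (auto simp: w_def)
    qed
    then show ?thesis
      by blast
  qed
  ultimately have "(\<Sum>k\<in>{1..q}. c \<bullet> w k) \<le> alpha P c * (real q - 1)"
    using J by (auto simp: blocking_def)
  then have "alpha P c \<le> (\<Sum>k\<in>{1..q}. alpha P c - c \<bullet> w k)"
    by (simp add: sum_subtractf algebra_simps)
  also have "\<dots> = (\<Sum>k\<in>{1..card I}. alpha P c - c \<bullet> w k)"
    using I(2) y(2) by (intro sum.mono_neutral_right) (auto simp: w_def)
  also have "\<dots> = (\<Sum>k\<in>{1..card I}. alpha P c - c \<bullet> z (h k))"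
    by (intro sum.cong) (auto simp: w_def)
  also have "\<dots> = (\<Sum>i\<in>I. alpha P c - c \<bullet> z i)"
    by (rule sum.reindex_bij_betw[OF h])
  finally show ?thesis .
qed

text \<open>
  The form in which stabilization is established: at depth \<open>q\<close> every covering family, of
  whatever length, already has deficit at least \<open>alpha P c\<close>.
\<close>

lemma stabilization_depth_leI:
  fixes P :: "(real ^ 'e::finite) set"
  assumes "1 \<le> q"
    and deficit: "\<And>c J l z. \<lbrakk>0 < alpha P c; J \<in> blocking P c q; \<And>i. i \<in> {1..l} \<Longrightarrow> z i \<in> P;
       \<And>e. e \<in> J \<Longrightarrow> \<exists>i\<in>{1..l}. e \<notin> supp (z i)\<rbrakk>
       \<Longrightarrow> alpha P c \<le> (\<Sum>i\<in>{1..l::nat}. alpha P c - c \<bullet> z i)"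
  shows "stabilization_depth P \<le> enat q"
proof -
  have "blocking P c q = blocking_inf P c" if c: "0 < alpha P c" for c
  proof
    show "blocking_inf P c \<subseteq> blocking P c q"
      using assms(1) by (auto simp: blocking_inf_def)
    show "blocking P c q \<subseteq> blocking_inf P c"
    proof
      fix J assume J: "J \<in> blocking P c q"
      have "J \<in> blocking P c l" for l
        unfolding blocking_def
      proof (intro CollectI allI impI)
        fix z :: "nat \<Rightarrow> real ^ 'e"
        assume z: "\<forall>i\<in>{1..l}. z i \<in> P" and "(\<Inter>i\<in>{1..l}. supp (z i)) \<inter> J = {}"
        then have "\<exists>i\<in>{1..l}. e \<notin> supp (z i)" if "e \<in> J" for e
          using that by blast
        with deficit[OF c J, of l z] z
        have "alpha P c \<le> (\<Sum>i\<in>{1..l}. alpha P c - c \<bullet> z i)"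
          by blast
        then show "(\<Sum>i\<in>{1..l}. c \<bullet> z i) \<le> alpha P c * (real l - 1)"
          by (simp add: sum_subtractf algebra_simps)
      qed
      then show "J \<in> blocking_inf P c"
        by (auto simp: blocking_inf_def)
    qed
  qed
  with assms(1) show ?thesis
    unfolding stabilization_depth_def by (intro INF_lower) auto
qed

section \<open>The breadth bound\<close>

text \<open>
  Choosing one index for each element of the union bounds the breadth by the size of the ground
  set, so the least number in the definition of the breadth exists and has its defining property.
\<close>

lemma union_breadth_works:
  fixes Z :: "'i \<Rightarrow> 'a::finite set"
  shows "1 \<le> union_breadth I Z"
    and "S \<subseteq> I \<Longrightarrow>
      \<exists>T\<subseteq>S. finite T \<and> card T \<le> union_breadth I Z \<and> (\<Union>j\<in>T. Z j) = (\<Union>j\<in>S. Z j)"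
proof -
  let ?Q = "\<lambda>q. 1 \<le> q \<and>
    (\<forall>S\<subseteq>I. \<exists>T\<subseteq>S. finite T \<and> card T \<le> q \<and> (\<Union>j\<in>T. Z j) = (\<Union>j\<in>S. Z j))"
  have "\<exists>T\<subseteq>S. finite T \<and> card T \<le> CARD('a) \<and> (\<Union>j\<in>T. Z j) = (\<Union>j\<in>S. Z j)" for S
  proof -
    let ?U = "\<Union>j\<in>S. Z j"
    have "\<forall>a\<in>?U. \<exists>j. j \<in> S \<and> a \<in> Z j"
      by blast
    then obtain f where f: "\<And>a. a \<in> ?U \<Longrightarrow> f a \<in> S \<and> a \<in> Z (f a)"
      by metis
    have "card (f ` ?U) \<le> CARD('a)"
      by (meson card_image_le card_mono finite finite_UNIV le_trans subset_UNIV)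
    moreover have "f ` ?U \<subseteq> S" "(\<Union>j\<in>f ` ?U. Z j) = ?U"
      using f by blast+
    ultimately show ?thesis
      by (intro exI[of _ "f ` ?U"]) auto
  qed
  then have "?Q (CARD('a))"
    by (simp add: Suc_leI)
  then have Q: "?Q (union_breadth I Z)"
    unfolding union_breadth_def by (rule LeastI)
  then show "1 \<le> union_breadth I Z"
    by blast
  show "\<exists>T\<subseteq>S. finite T \<and> card T \<le> union_breadth I Z \<and> (\<Union>j\<in>T. Z j) = (\<Union>j\<in>S. Z j)"
    if "S \<subseteq> I"
    using Q that by blast
qed

text \<open>
  On a set of nonnegative vectors, prescribing zeros cuts out a face, and so does maximizing
  \<open>c\<close> over that face. An extreme point of the resulting compact face is a vertex of \<open>P\<close>.
\<close>

lemma exists_vertex_of_zero_face: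
  fixes P :: "(real ^ 'e::finite) set"
  assumes "compact P" "convex P" and nonneg: "\<And>y e. y \<in> P \<Longrightarrow> 0 \<le> y $ e" and "z \<in> P"
  obtains v where "v extreme_point_of P" "zero_set z \<subseteq> zero_set v" "c \<bullet> z \<le> c \<bullet> v"
proof -
  define F where "F = P \<inter> (\<Inter>e\<in>zero_set z. {y. axis e 1 \<bullet> y = 0})"
  have F_iff: "y \<in> F \<longleftrightarrow> y \<in> P \<and> zero_set z \<subseteq> zero_set y" for y
    by (auto simp: F_def inner_axis' zero_set_def)
  have "compact F"
    unfolding F_def by (intro compact_Int_closed assms closed_INT ballI closed_hyperplane)
  have "convex F"
    unfolding F_def by (intro convex_Int assms convex_INT convex_hyperplane)
  have "F face_of P"
    unfolding face_of_def
  proof (intro conjI ballI impI)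
    show "F \<subseteq> P" "convex F"
      by (auto simp: F_def \<open>convex F\<close>[unfolded F_def])
  next
    fix a b x assume ab: "a \<in> P" "b \<in> P" and "x \<in> F" "x \<in> open_segment a b"
    then obtain u where u: "0 < u" "u < 1" "x = (1 - u) *\<^sub>R a + u *\<^sub>R b"
      by (auto simp: in_segment)
    have zeros: "a $ e = 0 \<and> b $ e = 0" if "e \<in> zero_set z" for e
    proof -
      have "(1 - u) * a $ e + u * b $ e = 0"
        using \<open>x \<in> F\<close> that u(3) by (auto simp: F_iff zero_set_def)
      moreover have "0 \<le> (1 - u) * a $ e" "0 \<le> u * b $ e"
        using u nonneg ab by simp_all
      ultimately have "(1 - u) * a $ e = 0" "u * b $ e = 0"
        by linarith+
      with u show ?thesis
        by simp
    qed
    then show "a \<in> F" "b \<in> F"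
      using ab by (auto simp: F_iff zero_set_def)
  qed
  have "z \<in> F"
    using \<open>z \<in> P\<close> by (simp add: F_iff)
  obtain y where y: "y \<in> F" "c \<bullet> y = alpha F c" "\<And>x. x \<in> F \<Longrightarrow> c \<bullet> x \<le> alpha F c"
    using alpha_attained[OF \<open>compact F\<close>] \<open>z \<in> F\<close> by blast
  let ?M = "F \<inter> {x. c \<bullet> x = alpha F c}"
  have "?M face_of F"
    using \<open>convex F\<close> y(3) by (intro face_of_Int_supporting_hyperplane_le) auto
  then have "?M face_of P"
    using \<open>F face_of P\<close> face_of_trans by blast
  have "compact ?M" "convex ?M" "?M \<noteq> {}"
    using y \<open>compact F\<close> \<open>convex F\<close>
    by (auto intro!: compact_Int_closed closed_hyperplane convex_Int convex_hyperplane)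
  then obtain v where v: "v extreme_point_of ?M"
    using extreme_point_exists_convex by blast
  then have "v \<in> ?M"
    by (simp add: extreme_point_of_def)
  moreover have "v extreme_point_of P"
    using v \<open>?M face_of P\<close> extreme_point_of_face by blast
  ultimately show ?thesis
    using y(3)[OF \<open>z \<in> F\<close>] by (intro that[of v]) (auto simp: F_iff)
qed

lemma stabilization_depth_le_zero_set_breadth:
  fixes P :: "(real ^ 'e::finite) set"
  assumes "compact P" "convex P" "P \<noteq> {}"
    and nonneg: "\<And>y e. y \<in> P \<Longrightarrow> 0 \<le> y $ e"
  shows "stabilization_depth P \<le> enat (zero_set_breadth P)"
proof (rule stabilization_depth_leI)
  show "1 \<le> zero_set_breadth P"
    unfolding zero_set_breadth_def by (rule union_breadth_works(1))
next
  fix c J and l :: nat and z :: "nat \<Rightarrow> real ^ 'e"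
  let ?a = "alpha P c"
  assume J: "J \<in> blocking P c (zero_set_breadth P)"
    and z: "\<And>i. i \<in> {1..l} \<Longrightarrow> z i \<in> P"
    and cover: "\<And>e. e \<in> J \<Longrightarrow> \<exists>i\<in>{1..l}. e \<notin> supp (z i)"
  have supp_iff: "e \<notin> supp y \<longleftrightarrow> e \<in> zero_set y" if "y \<in> P" for y e
    using nonneg[OF that, of e] by (auto simp: supp_def zero_set_def)
  have "\<exists>v. v extreme_point_of P \<and> zero_set (z i) \<subseteq> zero_set v \<and> c \<bullet> z i \<le> c \<bullet> v"
    if "i \<in> {1..l}" for i
    by (rule exists_vertex_of_zero_face[OF assms(1,2) nonneg z[OF that]]) auto
  then obtain r where r: "\<And>i. i \<in> {1..l} \<Longrightarrow>
      r i extreme_point_of P \<and> zero_set (z i) \<subseteq> zero_set (r i) \<and> c \<bullet> z i \<le> c \<bullet> r i"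
    by metis
  then have rP: "r i \<in> P" if "i \<in> {1..l}" for i
    using that by (simp add: extreme_point_of_def)
  have nonneg_deficit: "0 \<le> ?a - c \<bullet> r i" if "i \<in> {1..l}" for i
    using inner_le_alpha[OF \<open>compact P\<close> rP[OF that]] by simp
  have "?a \<le> (\<Sum>i\<in>{1..l}. ?a - c \<bullet> r i)"
  proof (cases "\<exists>i\<in>{1..l}. r i = 0")
    case True
    then obtain i where "i \<in> {1..l}" "r i = 0"
      by blast
    then show ?thesis
      using member_le_sum[of i "{1..l}" "\<lambda>i. ?a - c \<bullet> r i"] nonneg_deficit by auto
  next
    case False
    then have "r ` {1..l} \<subseteq> nonzero_vertices P"
      using r by (auto simp: nonzero_vertices_def)
    then obtain T where T: "T \<subseteq> r ` {1..l}" "card T \<le> zero_set_breadth P"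
        "(\<Union>v\<in>T. zero_set v) = (\<Union>v\<in>r ` {1..l}. zero_set v)"
      using union_breadth_works(2)[of "r ` {1..l}" "nonzero_vertices P" zero_set]
      unfolding zero_set_breadth_def by blast
    \<comment> \<open>Breadth selects vertices, while the deficits are summed over indices: pick one index for
      each selected vertex.\<close>
    then obtain I where I: "I \<subseteq> {1..l}" "inj_on r I" "T = r ` I"
      by (auto simp: subset_image_inj)
    have "finite I"
      using I(1) finite_subset by blast
    have "?a \<le> (\<Sum>i\<in>I. ?a - c \<bullet> r i)"
    proof (rule deficit_ge_if_blocking[OF assms(1,3) J \<open>finite I\<close>])
      show "card I \<le> zero_set_breadth P"
        using T(2) I by (simp add: card_image)
      show "r i \<in> P" if "i \<in> I" for i
        using that I(1) rP by blast
      show "\<exists>i\<in>I. e \<notin> supp (r i)" if "e \<in> J" for e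
      proof -
        obtain i where i: "i \<in> {1..l}" "e \<notin> supp (z i)"
          using cover \<open>e \<in> J\<close> by blast
        then have "e \<in> zero_set (r i)"
          using r supp_iff z by blast
        then have "e \<in> (\<Union>v\<in>T. zero_set v)"
          using i(1) T(3) by blast
        then obtain k where "k \<in> I" "e \<in> zero_set (r k)"
          using I(3) by blast
        then show ?thesis
          using supp_iff rP I(1) by blast
      qed
    qed
    also have "\<dots> \<le> (\<Sum>i\<in>{1..l}. ?a - c \<bullet> r i)"
      using I(1) nonneg_deficit by (intro sum_mono2) auto
    finally show ?thesis .
  qed
  also have "\<dots> \<le> (\<Sum>i\<in>{1..l}. ?a - c \<bullet> z i)"
    using r by (intro sum_mono) auto
  finally show "?a \<le> (\<Sum>i\<in>{1..l}. ?a - c \<bullet> z i)" .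
qed

section \<open>The dimension bound\<close>

text \<open>
  A covering family contains one with at most as many members as \<open>J\<close> has elements. A family of
  full size \<open>CARD('e)\<close> is handled by rescaling its sum, which stays in \<open>K\<close> because \<open>K\<close> is a
  convex cone.
\<close>

lemma stabilization_depth_le_card_minus_one:
  fixes K P :: "(real ^ 'e::finite) set"
  assumes card: "CARD('e) \<ge> 2" and "compact P" "P \<noteq> {}"
    and P: "P = K \<inter> {x. \<forall>e. 0 \<le> x $ e \<and> x $ e \<le> 1}"
    and K: "convex_cone K"
  shows "stabilization_depth P \<le> enat (CARD('e) - 1)"
proof (rule stabilization_depth_leI)
  show "1 \<le> CARD('e) - 1"
    using card by simp
next
  fix c J and l :: nat and z :: "nat \<Rightarrow> real ^ 'e"
  let ?a = "alpha P c" and ?n = "CARD('e)"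
  assume J: "J \<in> blocking P c (?n - 1)"
    and z: "\<And>i. i \<in> {1..l} \<Longrightarrow> z i \<in> P"
    and cover: "\<And>e. e \<in> J \<Longrightarrow> \<exists>i\<in>{1..l}. e \<notin> supp (z i)"
  obtain f where f: "\<And>e. e \<in> J \<Longrightarrow> f e \<in> {1..l} \<and> e \<notin> supp (z (f e))"
    using cover by metis
  define I where "I = f ` J"
  have I: "finite I" "I \<subseteq> {1..l}"
    using f by (auto simp: I_def)
  have zI: "z i \<in> P" if "i \<in> I" for i
    using that I(2) z by blast
  have "?a \<le> (\<Sum>i\<in>I. ?a - c \<bullet> z i)"
  proof (cases "card I \<le> ?n - 1")
    case True
    have "\<exists>i\<in>I. e \<notin> supp (z i)" if "e \<in> J" for e
      using f[OF that] that by (auto simp: I_def)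
    then show ?thesis
      using deficit_ge_if_blocking[OF assms(2,3) J I(1) True, of z] zI by blast
  next
    case False
    have "card I \<le> card J" "card J \<le> ?n"
      by (auto simp: I_def card_image_le card_mono)
    with False have cards: "card I = ?n" "card J = ?n"
      by linarith+
    then have "J = UNIV"
      by (simp add: card_eq_UNIV_imp_eq_UNIV)
    define s where "s = (\<Sum>i\<in>I. z i)"
    have "s \<in> K"
      unfolding s_def using I(1) zI
    proof (induction I)
      case empty
      then show ?case
        using convex_cone_contains_0[OF K] by simp
    next
      case (insert i I)
      then show ?case
        using convex_cone_add[OF K] by (simp add: P)
    qed
    \<comment> \<open>Each coordinate of \<open>s\<close> is a sum of \<open>?n\<close> numbers in the unit interval, one of which is 0;
      so \<open>?n - 1\<close> is the scaling that brings \<open>s\<close> back into the cube.\<close>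
    define x where "x = (1 / (real ?n - 1)) *\<^sub>R s"
    have n1: "0 < real ?n - 1"
      using card by simp
    have "x \<in> K"
      unfolding x_def using \<open>s \<in> K\<close> K n1 by (intro convex_cone_scaleR) auto
    moreover have "0 \<le> x $ e \<and> x $ e \<le> 1" for e
    proof -
      have "f e \<in> I"
        using \<open>J = UNIV\<close> by (simp add: I_def)
      have "z (f e) $ e = 0"
        using f[of e] \<open>J = UNIV\<close> zI[OF \<open>f e \<in> I\<close>]
        by (auto simp: P supp_def not_less intro: antisym)
      then have "s $ e = (\<Sum>i\<in>I - {f e}. z i $ e)"
        using I(1) \<open>f e \<in> I\<close> by (simp add: s_def sum.remove)
      also have "\<dots> \<le> (\<Sum>i\<in>I - {f e}. 1)"
        using zI by (intro sum_mono) (auto simp: P)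
      also have "\<dots> = real ?n - 1"
        using I(1) \<open>f e \<in> I\<close> cards card by simp
      finally have "s $ e \<le> real ?n - 1" .
      moreover have "0 \<le> s $ e"
        unfolding s_def sum_component using zI by (intro sum_nonneg) (auto simp: P)
      ultimately show ?thesis
        using n1 by (simp add: x_def)
    qed
    ultimately have "x \<in> P"
      by (simp add: P)
    then have "c \<bullet> x \<le> ?a"
      by (rule inner_le_alpha[OF assms(2)])
    then have "(\<Sum>i\<in>I. c \<bullet> z i) \<le> (real ?n - 1) * ?a"
      using n1 by (simp add: x_def s_def inner_sum_right field_simps)
    then show ?thesis
      using cards by (simp add: sum_subtractf algebra_simps)
  qed
  also have "\<dots> \<le> (\<Sum>i\<in>{1..l}. ?a - c \<bullet> z i)"
    using I inner_le_alpha[OF assms(2) z] by (intro sum_mono2) auto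
  finally show "?a \<le> (\<Sum>i\<in>{1..l}. ?a - c \<bullet> z i)" .
qed

section \<open>Both bounds for rational polyhedral cones\<close>

lemma closed_convex_cone_if_rational_polyhedral_cone:
  fixes K :: "(real ^ 'e::finite) set"
  assumes "rational_polyhedral_cone K"
  shows "closed K" "convex_cone K"
proof -
  obtain A where A: "K = {x. \<forall>a\<in>A. a \<bullet> x \<le> 0}"
    using assms by (auto simp: rational_polyhedral_cone_def)
  then have K: "K = (\<Inter>a\<in>A. {x. a \<bullet> x \<le> 0})"
    by blast
  show "closed K"
    unfolding K by (intro closed_INT ballI closed_halfspace_le)
  show "convex_cone K"
    unfolding K by (intro convex_cone_Inter) (auto intro: convex_cone_halfspace_le)
qed

theorem theorem3p2:
  fixes K P :: "(real ^ 'e::finite) set"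
  assumes "CARD('e) \<ge> 2"
    and "rational_polyhedral_cone K"
    and "K \<subseteq> {x. \<forall>e. 0 \<le> x $ e}"
    and "P = K \<inter> {x. \<forall>e. 0 \<le> x $ e \<and> x $ e \<le> 1}"
  shows "stabilization_depth P \<le> enat (zero_set_breadth P) \<and>
         stabilization_depth P \<le> enat (min (CARD('e) - 1) (zero_set_breadth P))"
proof -
  note K = closed_convex_cone_if_rational_polyhedral_cone[OF assms(2)]
  have "{x :: real ^ 'e. \<forall>e. 0 \<le> x $ e \<and> x $ e \<le> 1} = cbox 0 1"
    by (auto simp: mem_box_cart)
  then have P: "P = K \<inter> cbox 0 1"
    using assms(4) by simp
  have "compact P" "convex P"
    unfolding P using K by (auto intro: closed_Int_compact convex_Int simp: convex_cone_def)
  moreover have "0 \<in> P"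
    using convex_cone_contains_0[OF K(2)] assms(4) by simp
  moreover have "0 \<le> y $ e" if "y \<in> P" for y e
    using that assms(4) by simp
  ultimately have "stabilization_depth P \<le> enat (zero_set_breadth P)"
    by (intro stabilization_depth_le_zero_set_breadth) auto
  moreover have "stabilization_depth P \<le> enat (CARD('e) - 1)"
    using assms(1,4) K \<open>compact P\<close> \<open>0 \<in> P\<close>
    by (intro stabilization_depth_le_card_minus_one[of P K]) auto
  ultimately show ?thesis
    by (simp add: min_def)
qed

end
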